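(* Let $\mu\in\mathbb{R}$ and $\sigma>0$, and let $X$ be a real random variable following the Log-normal distribution with parameters $\mu$ and $\sigma$. Then for all positive integers $m,n$ with $n>m$, $$E(X^n)^{\frac{1}{n}} \geq E(X^m)^{\frac{1}{m}}.$$
   Context: The Log-normal distribution with parameters $\mu\in\mathbb{R}$ (logarithm of location) and $\sigma>0$ (logarithm of scale) is the probability distribution on $\mathbb{R}$ with density (with respect to Lebesgue measure) $f(x)=\frac{1}{\sqrt{2\pi}\,\sigma x}e^{-\frac{(\ln x-\mu)^2}{2\sigma^2}}$ for $x>0$ and $f(x)=0$ for $x\le 0$. For a positive integer $i$, $E(X^i)=\int_{-\infty}^{\infty}x^i f(x)\,dx$ denotes the $i$-th moment of $X$. *)

theory Defs
  imports "HOL-Probability.Probability"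
begin

definition lognormal_density :: "real \<Rightarrow> real \<Rightarrow> real \<Rightarrow> real" where
  "lognormal_density \<mu> \<sigma> x =
     (if x > 0 then 1 / (sqrt (2 * pi) * \<sigma> * x) * exp (- (ln x - \<mu>)\<^sup>2 / (2 * \<sigma>\<^sup>2)) else 0)"

end

theory Submission
  imports Defs
begin

text \<open>
  Completing the square in the exponent shows that \<open>x ^ i\<close> times the log-normal density with
  location \<open>\<mu>\<close> is \<open>exp (i \<mu> + i\<^sup>2 \<sigma>\<^sup>2 / 2)\<close> times the log-normal density with location
  \<open>\<mu> + i \<sigma>\<^sup>2\<close>. Hence the \<open>i\<close>-th moment is \<open>exp (i \<mu> + i\<^sup>2 \<sigma>\<^sup>2 / 2)\<close>, and its \<open>i\<close>-th root
  \<open>exp (\<mu> + i \<sigma>\<^sup>2 / 2)\<close> is increasing in \<open>i\<close>.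
\<close>

lemma lognormal_density_nonneg: "\<sigma> > 0 \<Longrightarrow> 0 \<le> lognormal_density \<mu> \<sigma> x"
  by (simp add: lognormal_density_def)

text \<open>The factor \<open>exp x\<close> is the Jacobian of the substitution
  \<open>y = exp x\<close> and cancels the \<open>1 / y\<close> in the density: the logarithm of a
  log-normal variable is normal.\<close>

lemma lognormal_density_exp_mult:
  assumes "\<sigma> > 0"
  shows "lognormal_density \<mu> \<sigma> (exp x) * exp x = normal_density \<mu> \<sigma> x"
  using assms by (simp add: lognormal_density_def normal_density_def real_sqrt_mult)

text \<open>Substituting \<open>exp\<close>, which maps the real line onto \<open>{0<..}\<close>,
  reduces this to the total mass of the normal density.\<close>

lemma has_bochner_integral_lognormal_density:
  assumes "\<sigma> > 0"
  shows "has_bochner_integral lborel (lognormal_density \<mu> \<sigma>) 1"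
proof -
  have supp: "indicat_real {0<..} x * lognormal_density \<mu> \<sigma> x = lognormal_density \<mu> \<sigma> x" for x
    by (simp add: lognormal_density_def indicator_def)
  \<comment> \<open>Near a positive point the case distinction in the density disappears, so
    continuity carries over from the closed formula.\<close>
  have cont: "isCont (lognormal_density \<mu> \<sigma>) (exp x)" for x
  proof -
    have "isCont (\<lambda>y. 1 / (sqrt (2 * pi) * \<sigma> * y) * exp (- (ln y - \<mu>)\<^sup>2 / (2 * \<sigma>\<^sup>2))) (exp x)"
      using assms by (intro continuous_intros) auto
    moreover have "\<forall>\<^sub>F y in nhds (exp x). lognormal_density \<mu> \<sigma> y
        = 1 / (sqrt (2 * pi) * \<sigma> * y) * exp (- (ln y - \<mu>)\<^sup>2 / (2 * \<sigma>\<^sup>2))"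
      using eventually_nhds_in_open[of "{0<..}" "exp x"]
      by (auto elim!: eventually_mono simp: lognormal_density_def)
    ultimately show ?thesis
      by (subst isCont_cong)
  qed
  have lim0: "((ereal \<circ> exp \<circ> real_of_ereal) \<longlongrightarrow> 0) (at_right (-\<infinity>))"
    by (simp add: zero_ereal_def exp_at_bot ereal_tendsto_simps)
  have lim1: "((ereal \<circ> exp \<circ> real_of_ereal) \<longlongrightarrow> \<infinity>) (at_left \<infinity>)"
    by (simp add: exp_at_top ereal_tendsto_simps)
  have int: "set_integrable lborel (einterval (-\<infinity>) \<infinity>) (\<lambda>x. lognormal_density \<mu> \<sigma> (exp x) * exp x)"
    using assms by (simp add: lognormal_density_exp_mult set_integrable_def)
  \<comment> \<open>For nonnegative integrands the rule yields integrability on the image interval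
    as well as equality of the integrals.\<close>
  note subst = interval_integral_substitution_nonneg[of "-\<infinity>" \<infinity> exp exp "lognormal_density \<mu> \<sigma>" 0 \<infinity>,
      OF _ DERIV_exp cont _ _ _ lim0 lim1 int]
  have "set_integrable lborel (einterval 0 \<infinity>) (lognormal_density \<mu> \<sigma>)"
    using assms by (intro subst(1)) (auto simp: lognormal_density_nonneg)
  moreover have "(LBINT x=0..\<infinity>. lognormal_density \<mu> \<sigma> x) =
      (LBINT x=-\<infinity>..\<infinity>. lognormal_density \<mu> \<sigma> (exp x) * exp x)"
    using assms by (intro subst(2)) (auto simp: lognormal_density_nonneg)
  moreover have "einterval 0 \<infinity> = {0<..}"
    by (auto simp: einterval_def)
  ultimately show ?thesis
    using assms
    by (simp add: has_bochner_integral_iff set_integrable_def supp interval_lebesgue_integral_def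
        set_lebesgue_integral_def lognormal_density_exp_mult)
qed

lemma lognormal_density_mult_power:
  assumes "\<sigma> > 0"
  shows "lognormal_density \<mu> \<sigma> x * x ^ i
    = exp (real i * \<mu> + (real i)\<^sup>2 * \<sigma>\<^sup>2 / 2) * lognormal_density (\<mu> + real i * \<sigma>\<^sup>2) \<sigma> x"
proof (cases "x > 0")
  case True
  \<comment> \<open>Since \<open>x ^ i = exp (i * ln x)\<close> for positive \<open>x\<close>, the
    power only adds a term linear in \<open>ln x\<close> to the exponent.\<close>
  have "- (ln x - \<mu>)\<^sup>2 / (2 * \<sigma>\<^sup>2) + real i * ln x
      = (real i * \<mu> + (real i)\<^sup>2 * \<sigma>\<^sup>2 / 2) + - (ln x - (\<mu> + real i * \<sigma>\<^sup>2))\<^sup>2 / (2 * \<sigma>\<^sup>2)"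
    using assms by (simp add: field_simps power2_eq_square)
  then have "exp (- (ln x - \<mu>)\<^sup>2 / (2 * \<sigma>\<^sup>2)) * exp (real i * ln x)
      = exp (real i * \<mu> + (real i)\<^sup>2 * \<sigma>\<^sup>2 / 2) * exp (- (ln x - (\<mu> + real i * \<sigma>\<^sup>2))\<^sup>2 / (2 * \<sigma>\<^sup>2))"
    by (simp only: exp_add[symmetric])
  moreover have "exp (real i * ln x) = x ^ i"
    using True by (simp add: exp_of_nat_mult)
  ultimately show ?thesis
    using True by (simp add: lognormal_density_def)
qed (simp add: lognormal_density_def)

lemma (in prob_space) lognormal_moment:
  assumes "\<sigma> > 0" and X: "distributed M lborel X (lognormal_density \<mu> \<sigma>)"
  shows "expectation (\<lambda>\<omega>. X \<omega> ^ i) = exp (real i * \<mu> + (real i)\<^sup>2 * \<sigma>\<^sup>2 / 2)"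
proof -
  have "expectation (\<lambda>\<omega>. X \<omega> ^ i) = (\<integral>x. lognormal_density \<mu> \<sigma> x * x ^ i \<partial>lborel)"
    using assms by (intro distributed_integral[OF X, symmetric]) (auto simp: lognormal_density_nonneg)
  also have "\<dots> = exp (real i * \<mu> + (real i)\<^sup>2 * \<sigma>\<^sup>2 / 2)"
    \<comment> \<open>The location stays schematic here, so that it can be instantiated with the
      shifted one.\<close>
    using has_bochner_integral_integral_eq[OF has_bochner_integral_lognormal_density[OF assms(1)]]
    by (simp add: lognormal_density_mult_power[OF assms(1)])
  finally show ?thesis .
qed

lemma (in prob_space) lognormal_moment_powr:
  assumes "\<sigma> > 0" and "distributed M lborel X (lognormal_density \<mu> \<sigma>)" and "i > 0"
  shows "expectation (\<lambda>\<omega>. X \<omega> ^ i) powr (1 / real i) = exp (\<mu> + real i * \<sigma>\<^sup>2 / 2)"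
  using assms by (simp add: lognormal_moment powr_def field_simps power2_eq_square)

theorem theorem3:
  fixes M :: "'a measure" and X :: "'a \<Rightarrow> real" and \<mu> \<sigma> :: real and m n :: nat
  assumes "prob_space M"
    and "\<sigma> > 0"
    and "distributed M lborel X (lognormal_density \<mu> \<sigma>)"
    and "m > 0" and "n > 0" and "n > m"
  shows "(prob_space.expectation M (\<lambda>\<omega>. X \<omega> ^ n)) powr (1 / real n)
           \<ge> (prob_space.expectation M (\<lambda>\<omega>. X \<omega> ^ m)) powr (1 / real m)"
  \<comment> \<open>By monotonicity of \<open>exp\<close>, only
    \<open>m * \<sigma>\<^sup>2 \<le> n * \<sigma>\<^sup>2\<close> remains.\<close>
  using assms by (simp add: prob_space.lognormal_moment_powr mult_right_mono)

end
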